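(* Let $k=-1$, let $h\in C([0,\infty);\mathbb{R})$ be fixed, let $z_0=(u_0,\rho_0)\in H^s\times H^{s-1}$ with $s>\frac52$, let $T$ be the maximal existence time of the corresponding solution $z=(u,\rho)$ to the system (HS) with initial data $z_0$, and let $a=\frac12\int_{\mathbb{S}}(\rho_0^2-u_{0,x}^2)\,dx$. The solution blows up in finite time if one of the following conditions holds: (1) $a<0$; (2) $a>0$ and there exists some $x_0\in\mathbb{S}$ such that $u_0'(x_0)<-\sqrt{2a}$; (3) $a=0$ and there exists some $x_0\in\mathbb{S}$ such that $u_0'(x_0)\le0$ and $\rho_0(x_0)\ne0$.
   Context: Notation: $\mathbb{S}=\mathbb{R}/\mathbb{Z}$, $H^r=H^r(\mathbb{S})$; functions on $\mathbb{S}$ are identified with 1-periodic functions on $\mathbb{R}$; $\partial_x^{-1}g(x)=\int_0^x g(y)\,dy$. For $k\in\{1,-1\}$, the periodic two-component Hunter-Saxton system is $u_{txx}+2u_xu_{xx}+uu_{xxx}-k\rho\rho_x=0$, $\rho_t+(\rho u)_x=0$, with 1-periodic $u,\rho$ and initial data $(u_0,\rho_0)$. Its solutions are understood through the following integrated form, with an arbitrary but fixed $h\in C([0,\infty);\mathbb{R})$, called (HS): $$\begin{cases} u_t+uu_x=\partial_x^{-1}\left(\frac k2\rho^2+\frac12u_x^2+a\right)+h(t), & t>0,\ x\in\mathbb{R},\\ \rho_t+(\rho u)_x=0, & t>0,\ x\in\mathbb{R},\\ u(0,x)=u_0(x),\ \rho(0,x)=\rho_0(x), & x\in\mathbb{R},\\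 u(t,x+1)=u(t,x),\ \rho(t,x+1)=\rho(t,x), & t\ge0,\ x\in\mathbb{R},\end{cases}$$ where $a=-\frac12\int_{\mathbb{S}}(k\rho_0^2+u_{0,x}^2)\,dx$. Known local well-posedness (used to define $T$): for $h\in C([0,\infty);\mathbb{R})$ and $z_0=(u_0,\rho_0)\in H^s\times H^{s-1}$ with $s\ge2$, there exist a maximal existence time $T\in(0,\infty]$ and a unique solution $z=(u,\rho)$ of (HS) with $z\in C([0,T);H^s\times H^{s-1})\cap C^1([0,T);H^{s-1}\times H^{s-2})$. The solution is said to blow up in finite time if $T<\infty$. *)

theory Defs
  imports "HOL-Analysis.Analysis"
begin

text \<open>
  Functions on the circle \<open>\<real>/\<int>\<close> are represented by 1-periodic functions \<open>real \<Rightarrow> real\<close>, and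
  time-dependent functions by \<open>f t x\<close> (time first).
\<close>

definition fourier_coeff :: "(real \<Rightarrow> real) \<Rightarrow> int \<Rightarrow> complex" where
  "fourier_coeff f n =
     (LINT x:{0..1}|lborel. complex_of_real (f x) * cis (- 2 * pi * real_of_int n * x))"

text \<open>
  \<open>H\<^sup>r\<close> of the circle for \<open>r \<ge> 0\<close>. Elements are honest functions, not classes modulo null sets;
  where point values matter, the continuous representative (which exists for \<open>r > 1/2\<close>) is
  requested separately.
\<close>

definition sobolev :: "real \<Rightarrow> (real \<Rightarrow> real) set" where
  "sobolev r = {f. (\<forall>x. f (x + 1) = f x) \<and> f \<in> borel_measurable borel \<and>
     set_integrable lborel {0..1} (\<lambda>x. (f x)\<^sup>2) \<and>
     (\<lambda>n::int. (1 + (real_of_int n)\<^sup>2) powr r * (cmod (fourier_coeff f n))\<^sup>2) summable_on UNIV}"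

definition sobolev_norm :: "real \<Rightarrow> (real \<Rightarrow> real) \<Rightarrow> real" where
  "sobolev_norm r f =
     sqrt (\<Sum>\<^sub>\<infinity>n::int. (1 + (real_of_int n)\<^sup>2) powr r * (cmod (fourier_coeff f n))\<^sup>2)"

text \<open>\<open>f \<in> C(I; H\<^sup>r)\<close>\<close>

definition sobolev_cont :: "real \<Rightarrow> real set \<Rightarrow> (real \<Rightarrow> real \<Rightarrow> real) \<Rightarrow> bool" where
  "sobolev_cont r I f \<longleftrightarrow> (\<forall>t\<in>I. f t \<in> sobolev r) \<and>
     (\<forall>t\<in>I. ((\<lambda>\<tau>. sobolev_norm r (\<lambda>x. f \<tau> x - f t x)) \<longlongrightarrow> 0) (at t within I))"

text \<open>\<open>f \<in> C\<^sup>1(I; H\<^sup>r)\<close> with time derivative \<open>f'\<close> (one-sided at an endpoint belonging to \<open>I\<close>)\<close>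

definition sobolev_C1_deriv ::
  "real \<Rightarrow> real set \<Rightarrow> (real \<Rightarrow> real \<Rightarrow> real) \<Rightarrow> (real \<Rightarrow> real \<Rightarrow> real) \<Rightarrow> bool" where
  "sobolev_C1_deriv r I f f' \<longleftrightarrow> sobolev_cont r I f \<and> sobolev_cont r I f' \<and>
     (\<forall>t\<in>I. ((\<lambda>\<tau>. sobolev_norm r (\<lambda>x. (f \<tau> x - f t x) / (\<tau> - t) - f' t x)) \<longlongrightarrow> 0)
              (at t within I))"

text \<open>\<open>\<partial>\<^sub>x\<^sup>-\<^sup>1\<close>; the interval integral is oriented, so this also covers \<open>x < 0\<close>.\<close>

definition dx_inv :: "(real \<Rightarrow> real) \<Rightarrow> real \<Rightarrow> real" where
  "dx_inv g x = (LBINT y=0..x. g y)"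

definition hs_const :: "real \<Rightarrow> (real \<Rightarrow> real) \<Rightarrow> (real \<Rightarrow> real) \<Rightarrow> real" where
  "hs_const k u0 \<rho>0 = - (1/2) * (LBINT x=0..1. k * (\<rho>0 x)\<^sup>2 + (deriv u0 x)\<^sup>2)"

definition time_interval :: "ereal \<Rightarrow> real set" where
  "time_interval T = {t. 0 \<le> t \<and> ereal t < T}"

text \<open>
  Solutions of (HS) on \<open>[0,T)\<close> of class
  \<open>C([0,T); H\<^sup>s \<times> H\<^sup>s\<^sup>-\<^sup>1) \<inter> C\<^sup>1([0,T); H\<^sup>s\<^sup>-\<^sup>1 \<times> H\<^sup>s\<^sup>-\<^sup>2)\<close>, intended for \<open>s > 5/2\<close>. In that range the
  continuous representatives \<open>u t\<close>, \<open>\<rho> t\<close> are continuously differentiable in \<open>x\<close> and the time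
  derivatives \<open>ut t\<close>, \<open>\<rho>t t\<close> have continuous representatives, so the equations are imposed at
  every \<open>x\<close>. Spatial 1-periodicity is part of membership in \<^const>\<open>sobolev\<close>.
\<close>

definition hs_solution ::
  "real \<Rightarrow> (real \<Rightarrow> real) \<Rightarrow> real \<Rightarrow> (real \<Rightarrow> real) \<Rightarrow> (real \<Rightarrow> real) \<Rightarrow> ereal \<Rightarrow>
   (real \<Rightarrow> real \<Rightarrow> real) \<Rightarrow> (real \<Rightarrow> real \<Rightarrow> real) \<Rightarrow> bool" where
  "hs_solution k h s u0 \<rho>0 T u \<rho> \<longleftrightarrow>
     sobolev_cont s (time_interval T) u \<and>
     sobolev_cont (s - 1) (time_interval T) \<rho> \<and>
     (\<forall>t\<in>time_interval T. continuous_on UNIV (u t) \<and> continuous_on UNIV (\<rho> t)) \<and>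
     u 0 = u0 \<and> \<rho> 0 = \<rho>0 \<and>
     (\<exists>ut \<rho>t.
        sobolev_C1_deriv (s - 1) (time_interval T) u ut \<and>
        sobolev_C1_deriv (s - 2) (time_interval T) \<rho> \<rho>t \<and>
        (\<forall>t\<in>time_interval T. t > 0 \<longrightarrow> (\<forall>x.
           ut t x + u t x * deriv (u t) x =
             dx_inv (\<lambda>y. k/2 * (\<rho> t y)\<^sup>2 + 1/2 * (deriv (u t) y)\<^sup>2 + hs_const k u0 \<rho>0) x + h t \<and>
           \<rho>t t x + deriv (\<lambda>y. \<rho> t y * u t y) x = 0)))"

text \<open>The solution \<open>(u, \<rho>)\<close> on \<open>[0,T)\<close> is maximal, i.e. \<open>T\<close> is its maximal existence time.\<close>

definition hs_maximal_solution ::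
  "real \<Rightarrow> (real \<Rightarrow> real) \<Rightarrow> real \<Rightarrow> (real \<Rightarrow> real) \<Rightarrow> (real \<Rightarrow> real) \<Rightarrow> ereal \<Rightarrow>
   (real \<Rightarrow> real \<Rightarrow> real) \<Rightarrow> (real \<Rightarrow> real \<Rightarrow> real) \<Rightarrow> bool" where
  "hs_maximal_solution k h s u0 \<rho>0 T u \<rho> \<longleftrightarrow>
     0 < T \<and> hs_solution k h s u0 \<rho>0 T u \<rho> \<and>
     \<not> (\<exists>T' u' \<rho>'. T < T' \<and> hs_solution k h s u0 \<rho>0 T' u' \<rho>' \<and>
          (\<forall>t\<in>time_interval T. u' t = u t \<and> \<rho>' t = \<rho> t))"

definition blows_up_in_finite_time :: "ereal \<Rightarrow> bool" where
  "blows_up_in_finite_time T \<longleftrightarrow> T < \<infinity>"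

end

theory Submission
  imports Defs
begin

text \<open>
  Suppose that the solution is global, and let \<open>m t\<close> be the minimum over the circle of the slope
  \<open>\<partial>\<^sub>x u t\<close>. Differentiating the first equation in \<open>x\<close> gives
  \<open>\<partial>\<^sub>t u\<^sub>x + u u\<^sub>x\<^sub>x = a - u\<^sub>x\<^sup>2/2 - \<rho>\<^sup>2/2\<close>. At a point where the slope is minimal the transport term
  \<open>u u\<^sub>x\<^sub>x\<close> vanishes, so the upper right Dini derivative of \<open>m\<close> is at most \<open>a - m\<^sup>2/2\<close>. Following the
  minimum takes the place of following a characteristic. A comparison with \<open>z' = c z\<^sup>2\<close> shows that \<open>m\<close> reaches
  \<open>-\<infinity>\<close> in finite time as soon as \<open>m 0 < 0\<close> and \<open>m 0\<^sup>2 > 2 a\<close>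
  (\<open>riccati_no_global_solution\<close>, \<open>hs_global_solution_not_steep\<close>).

  Each of the three conditions leads to such an initial slope. For \<open>a > 0\<close> it is assumed. For
  \<open>a \<le> 0\<close> a negative slope suffices, and if there is none then \<open>u0\<close> is nondecreasing
  and periodic, hence constant, so \<open>2 a\<close> is the integral of \<open>\<rho>0\<^sup>2\<close>: this is not negative, and it
  is zero only if \<open>\<rho>0\<close> vanishes everywhere.

  The analytic substance is the passage from the Sobolev classes to pointwise statements:
  \<open>u t\<close> is twice differentiable (\<open>sobolev_deriv_differentiable\<close>), its slope depends
  continuously on time, uniformly in \<open>x\<close> (\<open>sobolev_cont_deriv_uniform\<close>), and time and space
  derivatives commute (\<open>sobolev_C1_mixed_derivative\<close>). All of this rests on the Fourier inversion
  theorem for continuous functions with absolutely summable coefficients (\<open>fourier_inversion\<close>) and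
  on termwise differentiation.
\<close>

section \<open>Uniqueness of Fourier coefficients\<close>

text \<open>
  The condition ranges over all integers, so the sign in the exponent does not matter; continuity is
  part of the notion because it makes all integrals involved exist.
\<close>

definition trig_orthogonal :: "(real \<Rightarrow> complex) \<Rightarrow> bool" where
  "trig_orthogonal g \<longleftrightarrow> continuous_on {0..1} g \<and>
     (\<forall>n::int. integral {0..1} (\<lambda>x. g x * cis (2 * pi * of_int n * x)) = 0)"

lemma trig_orthogonal_add:
  assumes "trig_orthogonal f" "trig_orthogonal g"
  shows "trig_orthogonal (\<lambda>x. f x + g x)"
  using assms unfolding trig_orthogonal_def
  by (auto simp: distrib_right intro!: continuous_intros
      integral_add[THEN trans] integrable_continuous_real)

lemma trig_orthogonal_cmult:
  assumes "trig_orthogonal g"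
  shows "trig_orthogonal (\<lambda>x. c * g x)"
  using assms unfolding trig_orthogonal_def
  by (auto simp: mult.assoc intro!: continuous_intros)

text \<open>
  Multiplication by a character only permutes the orthogonality conditions.
\<close>

lemma trig_orthogonal_shift:
  assumes "trig_orthogonal g"
  shows "trig_orthogonal (\<lambda>x. g x * cis (2 * pi * of_int k * x))"
proof -
  have eq: "g x * cis (2 * pi * of_int k * x) * cis (2 * pi * of_int n * x)
      = g x * cis (2 * pi * of_int (k + n) * x)" for n :: int and x
    by (simp add: mult.assoc cis_mult algebra_simps)
  have "continuous_on {0..1} g" "\<And>n::int. integral {0..1} (\<lambda>x. g x * cis (2 * pi * of_int n * x)) = 0"
    using assms unfolding trig_orthogonal_def by auto
  then show ?thesis
    unfolding trig_orthogonal_def eq by (auto intro!: continuous_intros simp del: of_int_add)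
qed

text \<open>
  A polynomial in the coordinates of \<^term>\<open>cis (2 * pi * x)\<close> is a trigonometric polynomial, and
  the class of functions orthogonal to all characters is a module over those. Quantifying over
  \<open>g\<close> inside the induction settles products without ever writing a polynomial as a
  combination of characters.
\<close>

lemma trig_orthogonal_real_polynomial:
  assumes "real_polynomial_function p" "trig_orthogonal g"
  shows "trig_orthogonal (\<lambda>x. g x * of_real (p (cis (2 * pi * x))))"
  using assms
proof (induction arbitrary: g rule: real_polynomial_function.induct)
  case (linear L)
  then interpret L: bounded_linear L by simp
  define c where "c = (of_real (L 1) - \<i> * of_real (L \<i>)) / 2"
  define d where "d = (of_real (L 1) + \<i> * of_real (L \<i>)) / 2"
  \<comment> \<open>Euler: a real-linear functional of \<open>cis y\<close> combines \<open>cis y\<close> and \<open>cis (- y)\<close>.\<close>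
  have "L (cis y) = L (cos y *\<^sub>R 1 + sin y *\<^sub>R \<i>)" for y
    by (intro arg_cong[where f=L]) (auto simp: complex_eq_iff)
  then have "L (cis y) = cos y * L 1 + sin y * L \<i>" for y
    by (simp add: L.add L.scaleR)
  then have "of_real (L (cis y)) = c * cis y + d * cis (- y)" for y
    by (simp add: c_def d_def complex_eq_iff field_simps)
  then have "(\<lambda>x. g x * of_real (L (cis (2 * pi * x)))) =
      (\<lambda>x. c * (g x * cis (2 * pi * of_int 1 * x)) + d * (g x * cis (2 * pi * of_int (-1) * x)))"
    by (simp add: fun_eq_iff algebra_simps)
  then show ?case
    by (simp only:) (intro trig_orthogonal_add trig_orthogonal_cmult trig_orthogonal_shift linear)
next
  case (const c)
  then show ?case
    using trig_orthogonal_cmult[of g "of_real c"] by (simp add: mult.commute)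
next
  case (add p q)
  then show ?case
    using trig_orthogonal_add[OF add.IH(1) add.IH(2), of g g] by (simp add: distrib_left)
next
  case (mult p q)
  then show ?case
    using mult.IH(2)[OF mult.IH(1)] by (simp add: mult.assoc)
qed

lemma cis_eq_on_unit_interval:
  assumes "cis (2 * pi * x) = cis (2 * pi * y)" "x \<in> {0..1}" "y \<in> {0..1}"
  shows "x = y \<or> {x, y} = {0, 1}"
proof -
  have "sin (2 * pi * x) = sin (2 * pi * y) \<and> cos (2 * pi * x) = cos (2 * pi * y)"
    using assms(1) by (simp add: complex_eq_iff)
  then obtain n :: int where "2 * pi * x = 2 * pi * y + 2 * pi * n"
    using sin_cos_eq_iff by (metis mult.assoc)
  then have "2 * pi * x = 2 * pi * (y + n)" by (simp add: algebra_simps)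
  then have n: "x = y + n" by simp
  have "n = 0 \<or> n = 1 \<or> n = -1"
    using n assms(2,3) by auto
  then show ?thesis using n assms(2,3) by auto
qed

text \<open>
  The map \<open>x \<mapsto> cis (2 * pi * x)\<close> from the unit interval onto the circle identifies only the two
  endpoints and, by compactness, carries closed sets to closed sets. Hence preimages of closed sets
  under the induced function are closed.
\<close>

lemma circle_factorization:
  fixes f :: "real \<Rightarrow> real"
  assumes f: "continuous_on {0..1} f" "f 0 = f 1"
  obtains F :: "complex \<Rightarrow> real"
  where "continuous_on (sphere 0 1) F" "\<And>x. x \<in> {0..1} \<Longrightarrow> F (cis (2 * pi * x)) = f x"
proof -
  define e where "e x = cis (2 * pi * x)" for x
  define F where "F z = f (inv_into {0..1} e z)" for z
  have Fe: "F (e x) = f x" if "x \<in> {0..1}" for x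
  proof -
    let ?y = "inv_into {0..1} e (e x)"
    have "?y \<in> {0..1}" "e ?y = e x"
      using that by (blast intro: inv_into_into f_inv_into_f)+
    then have "?y = x \<or> {?y, x} = {0, 1}"
      unfolding e_def using cis_eq_on_unit_interval that by blast
    then show ?thesis using f(2) by (auto simp: F_def doubleton_eq_iff)
  qed
  have onto: "e ` {0..1} = sphere 0 1"
  proof -
    have "z \<in> e ` {0..1}" if "norm z = 1" for z
    proof
      show "z = e (Arg2pi z / (2 * pi))"
        using Arg2pi_eq[of z] that by (simp add: e_def cis_conv_exp)
      show "Arg2pi z / (2 * pi) \<in> {0..1}"
        using Arg2pi_ge_0[of z] Arg2pi_lt_2pi[of z] by (simp add: field_simps)
    qed
    then show ?thesis by (auto simp: e_def)
  qed
  have "closed (F -` B \<inter> sphere 0 1)" if "closed B" for B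
  proof -
    have "F -` B \<inter> sphere 0 1 = e ` ({0..1} \<inter> f -` B)"
      unfolding onto[symmetric] using Fe by auto
    moreover have "compact ({0..1} \<inter> f -` B)"
      using continuous_closed_preimage[OF f(1) closed_atLeastAtMost that]
      by (simp add: compact_eq_bounded_closed bounded_Int)
    ultimately show ?thesis
      unfolding e_def by (simp only:) (intro compact_imp_closed compact_continuous_image continuous_intros)
  qed
  then have "continuous_on (sphere 0 1) F"
    by (simp add: continuous_on_closed_vimage)
  then show ?thesis using that Fe by (auto simp: e_def)
qed

text \<open>
  With \<open>f = Re g\<close>, Stone--Weierstrass on the circle gives a trigonometric polynomial \<open>q\<close> within
  \<open>\<epsilon>\<close> of \<open>f\<close>. Since \<open>f\<close> is orthogonal to the real function \<open>q\<close>, the integral of \<open>f\<^sup>2\<close> equals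
  that of \<open>f (f - q)\<close>, which is at most \<open>\<epsilon>\<close> times the integral of \<open>\<bar>f\<bar>\<close>.
\<close>

lemma trig_orthogonal_Re_eq_0:
  assumes g: "trig_orthogonal g" and per: "g 0 = g 1" and x: "x \<in> {0..1}"
  shows "Re (g x) = 0"
proof -
  define f where "f x = Re (g x)" for x
  have contg: "continuous_on {0..1} g"
    using g by (simp add: trig_orthogonal_def)
  then have cont: "continuous_on {0..1} f"
    unfolding f_def by (intro continuous_intros)
  define I where "I = integral {0..1} (\<lambda>x. (f x)\<^sup>2)"
  define J where "J = integral {0..1} (\<lambda>x. \<bar>f x\<bar>)"
  obtain F where F: "continuous_on (sphere 0 1) F"
      "\<And>x. x \<in> {0..1} \<Longrightarrow> F (cis (2 * pi * x)) = f x"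
    using circle_factorization[OF cont] per by (auto simp: f_def)
  have J0: "0 \<le> J" 
    unfolding J_def using cont by (intro integral_nonneg integrable_continuous_real continuous_intros) auto
  have small: "I \<le> \<epsilon> * J" if eps: "\<epsilon> > 0" for \<epsilon>
  proof -
    obtain p where p: "real_polynomial_function p" "\<And>z. z \<in> sphere 0 1 \<Longrightarrow> \<bar>F z - p z\<bar> < \<epsilon>"
      using Stone_Weierstrass_real_polynomial_function[OF compact_sphere F(1) eps] by metis
    define q where "q x = p (cis (2 * pi * x))" for x
    have contq: "continuous_on {0..1} q"
      unfolding q_def
    proof (rule continuous_on_compose2[of UNIV p])
      show "continuous_on UNIV p"
        using continuous_on_polymonial_function[of p] p(1) by (simp add: real_polynomial_function_eq)
    qed (auto intro!: continuous_intros)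
    have "integral {0..1} (\<lambda>x. g x * of_real (q x)) = 0"
      using trig_orthogonal_real_polynomial[OF p(1) g]
      unfolding trig_orthogonal_def q_def by (auto dest!: spec[of _ 0])
    moreover have "Re (integral {0..1} (\<lambda>x. g x * of_real (q x))) = integral {0..1} (\<lambda>x. f x * q x)"
      using integral_linear[OF _ bounded_linear_Re, of "\<lambda>x. g x * of_real (q x)" "{0..1}"] contg contq
      by (simp add: o_def f_def integrable_continuous_real continuous_intros)
    ultimately have "integral {0..1} (\<lambda>x. f x * q x) = 0" by simp
    moreover have "I - integral {0..1} (\<lambda>x. f x * q x) = integral {0..1} (\<lambda>x. f x * (f x - q x))"
      unfolding I_def using cont contq
      by (subst integral_diff[symmetric]) (auto intro!: integrable_continuous_real continuous_intros
          simp: power2_eq_square right_diff_distrib)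
    ultimately have "I = integral {0..1} (\<lambda>x. f x * (f x - q x))" by simp
    also have "\<dots> \<le> integral {0..1} (\<lambda>x. \<epsilon> * \<bar>f x\<bar>)"
    proof (rule integral_le)
      fix y :: real assume y: "y \<in> {0..1}"
      have "\<bar>f y - q y\<bar> < \<epsilon>"
        using p(2)[of "cis (2 * pi * y)"] F(2)[OF y] by (simp add: q_def)
      then have "\<bar>f y\<bar> * \<bar>f y - q y\<bar> \<le> \<bar>f y\<bar> * \<epsilon>"
        by (intro mult_left_mono) auto
      then show "f y * (f y - q y) \<le> \<epsilon> * \<bar>f y\<bar>"
        using abs_ge_self[of "f y * (f y - q y)"] by (simp add: abs_mult mult.commute)
    qed (use cont contq in \<open>auto intro!: integrable_continuous_real continuous_intros\<close>)
    also have "\<dots> = \<epsilon> * J" by (simp add: J_def)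
    finally show ?thesis .
  qed
  have "I \<le> 0 + \<delta>" if "\<delta> > 0" for \<delta>
  proof -
    have "I \<le> \<delta> / (J + 1) * J" using J0 that by (intro small) auto
    also have "\<dots> \<le> \<delta>" using J0 that by (simp add: field_simps)
    finally show ?thesis by simp
  qed
  then have "I \<le> 0" by (rule field_le_epsilon)
  moreover have "0 \<le> I"
    unfolding I_def using cont by (intro integral_nonneg integrable_continuous_real continuous_intros) auto
  ultimately have "I = 0" by simp
  then show ?thesis
    using x cont unfolding I_def
    by (subst (asm) integral_eq_0_iff) (auto intro!: continuous_intros simp: f_def)
qed

lemma trig_orthogonal_eq_0:
  assumes "trig_orthogonal g" "g 0 = g 1" "x \<in> {0..1}"
  shows "g x = 0"
  using trig_orthogonal_Re_eq_0[OF assms]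
    trig_orthogonal_Re_eq_0[OF trig_orthogonal_cmult[OF assms(1), of "- \<i>"]] assms(2,3)
  by (auto simp: complex_eq_iff)

section \<open>Absolutely convergent trigonometric series\<close>

lemma
  fixes f :: "'a \<Rightarrow> real \<Rightarrow> complex"
  assumes cont: "\<And>n. continuous_on {a..b} (f n)"
    and bound: "\<And>n x. x \<in> {a..b} \<Longrightarrow> norm (f n x) \<le> M n" and "M summable_on UNIV"
  shows continuous_on_dominated_infsum: "continuous_on {a..b} (\<lambda>x. \<Sum>\<^sub>\<infinity>n. f n x)"
    and has_sum_integral_dominated: "((\<lambda>n. integral {a..b} (f n)) has_sum
       integral {a..b} (\<lambda>x. \<Sum>\<^sub>\<infinity>n. f n x)) UNIV"
proof -
  have u: "uniform_limit {a..b} (\<lambda>X x. \<Sum>n\<in>X. f n x) (\<lambda>x. \<Sum>\<^sub>\<infinity>n. f n x) (finite_subsets_at_top UNIV)"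
    by (rule Weierstrass_m_test_general[OF bound assms(3)])
  show "continuous_on {a..b} (\<lambda>x. \<Sum>\<^sub>\<infinity>n. f n x)"
    by (rule uniform_limit_theorem[OF _ u]) (auto intro!: always_eventually continuous_intros cont)
  obtain I J where IJ: "\<And>X. ((\<lambda>x. \<Sum>n\<in>X. f n x) has_integral I X) {a..b}"
      "((\<lambda>x. \<Sum>\<^sub>\<infinity>n. f n x) has_integral J) {a..b}" "(I \<longlongrightarrow> J) (finite_subsets_at_top UNIV)"
    by (rule uniform_limit_integral[OF u]) (auto intro!: continuous_intros cont)
  have "I X = (\<Sum>n\<in>X. integral {a..b} (f n))" if "finite X" for X
    using that IJ(1)[of X, THEN integral_unique] cont
    by (simp add: integral_sum integrable_continuous_real)
  then have "((\<lambda>X. \<Sum>n\<in>X. integral {a..b} (f n)) \<longlongrightarrow> J) (finite_subsets_at_top UNIV)"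
    using IJ(3) by (subst tendsto_cong[of _ I]) 
      (auto intro!: eventually_finite_subsets_at_top_weakI)
  then show "((\<lambda>n. integral {a..b} (f n)) has_sum integral {a..b} (\<lambda>x. \<Sum>\<^sub>\<infinity>n. f n x)) UNIV"
    using IJ(2)[THEN integral_unique] by (simp add: has_sum_def)
qed

definition trig_series :: "(int \<Rightarrow> complex) \<Rightarrow> real \<Rightarrow> complex" where
  "trig_series c x = (\<Sum>\<^sub>\<infinity>n. c n * cis (2 * pi * of_int n * x))"

lemma trig_series_periodic: "trig_series c (x + 1) = trig_series c x"
proof -
  have "cis (2 * pi * of_int n * (x + 1)) = cis (2 * pi * of_int n * x)" for n
    by (simp add: distrib_left flip: cis_mult) 
  then show ?thesis by (simp add: trig_series_def)
qed

lemma continuous_on_trig_series: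
  assumes "(\<lambda>n. norm (c n)) summable_on UNIV"
  shows "continuous_on {a..b} (trig_series c)"
  unfolding trig_series_def
  by (rule continuous_on_dominated_infsum[where M="\<lambda>n. norm (c n)"])
    (auto intro!: continuous_intros simp: norm_mult assms)

lemma norm_trig_series_le:
  assumes "(\<lambda>n. norm (c n)) summable_on UNIV"
  shows "norm (trig_series c x) \<le> (\<Sum>\<^sub>\<infinity>n. norm (c n))"
  unfolding trig_series_def
  using norm_infsum_bound[of "\<lambda>n. c n * cis (2 * pi * of_int n * x)" UNIV] assms by (simp add: norm_mult)

lemma integral_cis:
  fixes k :: int
  assumes "k \<noteq> 0" "a \<le> b"
  shows "integral {a..b} (\<lambda>x. cis (2 * pi * of_int k * x)) =
    (cis (2 * pi * of_int k * b) - cis (2 * pi * of_int k * a)) / (2 * pi * \<i> * of_int k)"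
proof -
  have "((\<lambda>x. cis (2 * pi * of_int k * x)) has_integral
     (cis (2 * pi * of_int k * b) / (2 * pi * \<i> * of_int k)
      - cis (2 * pi * of_int k * a) / (2 * pi * \<i> * of_int k))) {a..b}"
  proof (intro fundamental_theorem_of_calculus assms)
    fix x :: real
    have "((\<lambda>z. exp (2 * pi * \<i> * of_int k * z) / (2 * pi * \<i> * of_int k))
      has_field_derivative exp (2 * pi * \<i> * of_int k * of_real x)) (at (of_real x))"
      using assms by (auto intro!: derivative_eq_intros)
    then show "((\<lambda>x. cis (2 * pi * of_int k * x) / (2 * pi * \<i> * of_int k))
      has_vector_derivative cis (2 * pi * of_int k * x)) (at x within {a..b})"
      by (drule_tac has_vector_derivative_real_field) (simp add: cis_conv_exp mult_ac)
  qed
  then show ?thesis by (simp add: diff_divide_distrib integral_unique)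
qed

lemma integral_cis_period:
  "integral {0..1} (\<lambda>x. cis (2 * pi * of_int k * x)) = (if k = 0 then 1 else 0)"
  using integral_cis[of k 0 1] by (auto)

lemma trig_series_coefficient:
  assumes "(\<lambda>n. norm (c n)) summable_on UNIV"
  shows "integral {0..1} (\<lambda>x. trig_series c x * cis (2 * pi * of_int m * x)) = c (- m)"
proof -
  let ?f = "\<lambda>n x. c n * cis (2 * pi * of_int (n + m) * x)"
  have "?f n x = c n * cis (2 * pi * of_int n * x) * cis (2 * pi * of_int m * x)" for n x
    by (simp add: mult.assoc cis_mult algebra_simps)
  then have "(\<lambda>x. trig_series c x * cis (2 * pi * of_int m * x)) = (\<lambda>x. \<Sum>\<^sub>\<infinity>n. ?f n x)"
    unfolding trig_series_def by (simp only: infsum_cmult_left')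
  moreover have "((\<lambda>n. integral {0..1} (?f n)) has_sum integral {0..1} (\<lambda>x. \<Sum>\<^sub>\<infinity>n. ?f n x)) UNIV"
    by (rule has_sum_integral_dominated[where M="\<lambda>n. norm (c n)"])
      (auto intro!: continuous_intros simp: norm_mult assms)
  moreover have "integral {0..1} (?f n) = (if n = - m then c (- m) else 0)" for n
    by (subst integral_mult_right, subst integral_cis_period) auto
  moreover have "((\<lambda>n. if n = - m then c (- m) else 0) has_sum c (- m)) UNIV"
    by (rule has_sum_finite_neutralI[of "{- m}"]) auto
  ultimately show ?thesis
    by (simp add: has_sum_unique)
qed

text \<open>
  The differentiated series may be integrated termwise, and its integral is the original series up
  to a constant; the fundamental theorem of calculus does the rest.
\<close>

lemma trig_series_has_vector_derivative:
  assumes c: "(\<lambda>n. norm (c n)) summable_on UNIV" and nc: "(\<lambda>n. norm (2 * pi * \<i> * of_int n * c n)) summable_on UNIV"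
  shows "(trig_series c has_vector_derivative trig_series (\<lambda>n. 2 * pi * \<i> * of_int n * c n) x) (at x)"
proof -
  let ?d = "\<lambda>n::int. 2 * pi * \<i> * of_int n * c n"
  \<comment> \<open>Any base point to the left of \<open>x\<close> serves.\<close>
  define A where "A = x - 1"
  have summ: "(\<lambda>n. c n * cis (2 * pi * of_int n * y)) summable_on UNIV" for y
    by (rule abs_summable_summable) (use c in \<open>simp add: norm_mult\<close>)
  have eq: "integral {A..y} (trig_series ?d) = trig_series c y - trig_series c A" if "A \<le> y" for y
  proof -
    have "((\<lambda>n. integral {A..y} (\<lambda>x. ?d n * cis (2 * pi * of_int n * x))) has_sum
        integral {A..y} (trig_series ?d)) UNIV"
      unfolding trig_series_def
      by (rule has_sum_integral_dominated[where M="\<lambda>n. norm (?d n)"])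
        (use nc in \<open>auto intro!: continuous_intros simp: norm_mult\<close>)
    moreover have "integral {A..y} (\<lambda>x. ?d n * cis (2 * pi * of_int n * x))
       = c n * cis (2 * pi * of_int n * y) - c n * cis (2 * pi * of_int n * A)" for n
    proof (cases "n = 0")
      case False
      let ?X = "cis (2 * pi * of_int n * y) - cis (2 * pi * of_int n * A)"
      have "?d n * (?X / (2 * pi * \<i> * of_int n)) = c n * ?X"
        using False by simp
      then show ?thesis
        using integral_cis[OF False that] by (simp add: right_diff_distrib)
    qed simp
    moreover have "((\<lambda>n. c n * cis (2 * pi * of_int n * y) + - (c n * cis (2 * pi * of_int n * A)))
       has_sum (trig_series c y + - trig_series c A)) UNIV"
      unfolding trig_series_def by (intro has_sum_add has_sum_uminusI has_sum_infsum summ)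
    ultimately show ?thesis by (simp add: has_sum_unique)
  qed
  have "((\<lambda>y. integral {A..y} (trig_series ?d)) has_vector_derivative trig_series ?d x) (at x within {A..x+1})"
    by (intro integral_has_vector_derivative continuous_on_trig_series nc) (auto simp: A_def)
  then have "((\<lambda>y. integral {A..y} (trig_series ?d)) has_vector_derivative trig_series ?d x) (at x)"
    by (subst (asm) at_within_interior) (auto simp: A_def)
  then have "((\<lambda>y. trig_series c y - trig_series c A) has_vector_derivative trig_series ?d x) (at x)"
    by (rule has_vector_derivative_transform_within_open[of _ _ _ "{A<..}"])
      (use eq in \<open>auto simp: A_def\<close>)
  from has_vector_derivative_add[OF this has_vector_derivative_const[of "trig_series c A"]]
  show ?thesis by simp
qed

section \<open>Fourier coefficients\<close>

lemma set_lebesgue_integral_eq_integral_01: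
  fixes f :: "real \<Rightarrow> 'b::euclidean_space"
  assumes "continuous_on {0..1} f"
  shows "set_lebesgue_integral lborel {0..1} f = integral {0..1} f"
  by (intro set_borel_integral_eq_integral borel_integrable_atLeastAtMost' assms)

lemma fourier_coeff_eq_integral:
  assumes "continuous_on {0..1} f"
  shows "fourier_coeff f n = integral {0..1} (\<lambda>x. of_real (f x) * cis (2 * pi * of_int (- n) * x))"
  unfolding fourier_coeff_def 
  by (subst set_lebesgue_integral_eq_integral_01) (auto intro!: continuous_intros assms)

lemma fourier_coeff_linear:
  assumes "continuous_on {0..1} f" "continuous_on {0..1} g"
  shows "fourier_coeff (\<lambda>x. a * f x + b * g x) n = of_real a * fourier_coeff f n + of_real b * fourier_coeff g n"
proof -
  let ?e = "\<lambda>x. cis (2 * pi * of_int (- n) * x)"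
  have "fourier_coeff (\<lambda>x. a * f x + b * g x) n =
     integral {0..1} (\<lambda>x. of_real a * (of_real (f x) * ?e x) + of_real b * (of_real (g x) * ?e x))"
    using assms by (subst fourier_coeff_eq_integral) (auto intro!: continuous_intros simp: algebra_simps)
  also have "\<dots> = of_real a * fourier_coeff f n + of_real b * fourier_coeff g n"
    using assms by (subst integral_add)
     (auto intro!: continuous_intros integrable_continuous_real simp: fourier_coeff_eq_integral)
  finally show ?thesis .
qed

lemma periodic_reduce_unit_interval:
  fixes x :: real
  assumes "\<And>x. f (x + 1) = f x"
  shows "f (frac x) = f x"
proof -
  have nat: "f (y + of_nat n) = f y" for y n
  proof (induction n)
    case (Suc n)
    have "f (y + of_nat (Suc n)) = f (y + of_nat n + 1)" by (simp add: add_ac)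
    then show ?case using Suc assms by simp
  qed simp
  have int: "f (y + of_int m) = f y" for y m
  proof (cases m)
    case (nonneg n) then show ?thesis using nat by simp
  next
    case (neg n) then show ?thesis using nat[of "y + of_int m" "Suc n"] by simp
  qed
  show ?thesis using int[of "frac x" "\<lfloor>x\<rfloor>"] by (simp add: frac_def)
qed

text \<open>
  The difference of the two sides is continuous and periodic and has vanishing Fourier coefficients,
  so it is zero by the uniqueness result above.
\<close>

lemma fourier_inversion:
  assumes f: "continuous_on UNIV f" and per: "\<And>x. f (x + 1) = f x"
    and c: "(\<lambda>n. norm (fourier_coeff f n)) summable_on UNIV"
  shows "of_real (f x) = trig_series (fourier_coeff f) x"
proof -
  define g where "g x = of_real (f x) - trig_series (fourier_coeff f) x" for x
  have f01: "continuous_on {0..1} f" using f by (rule continuous_on_subset) auto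
  have ct: "continuous_on {0..1} (trig_series (fourier_coeff f))"
    by (rule continuous_on_trig_series[OF c])
  have "integral {0..1} (\<lambda>x. g x * cis (2 * pi * of_int n * x)) = 0" for n :: int
  proof -
    have "integral {0..1} (\<lambda>x. g x * cis (2 * pi * of_int n * x)) =
      integral {0..1} (\<lambda>x. of_real (f x) * cis (2 * pi * of_int n * x))
      - integral {0..1} (\<lambda>x. trig_series (fourier_coeff f) x * cis (2 * pi * of_int n * x))"
      unfolding g_def left_diff_distrib
      by (intro integral_diff integrable_continuous_real continuous_intros f01 ct)
    then show ?thesis
      using trig_series_coefficient[OF c, of n] fourier_coeff_eq_integral[OF f01, of "- n"] by simp
  qed
  then have "trig_orthogonal g"
    unfolding trig_orthogonal_def g_def using f01 ct by (auto intro!: continuous_intros)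
  moreover have perg: "g (x + 1) = g x" for x
    by (simp add: g_def per trig_series_periodic)
  ultimately have "g (frac x) = 0"
    using perg[of 0] by (intro trig_orthogonal_eq_0) (auto simp: frac_ge_0 less_imp_le frac_lt_1)
  then have "g x = 0" using periodic_reduce_unit_interval[of g, OF perg] by simp
  then show ?thesis by (simp add: g_def)
qed

section \<open>Regularity of Sobolev functions\<close>

lemma summable_on_int_bracket_powr:
  fixes q :: real
  assumes "q > 1/2"
  shows "(\<lambda>n::int. (1 + (real_of_int n)\<^sup>2) powr (- q)) summable_on UNIV"
proof -
  define h where "h n = (1 + (real_of_int n)\<^sup>2) powr (- q)" for n
  have bound: "h n \<le> of_nat k powr (- 2 * q)" if "k > 0" "of_nat k \<le> \<bar>real_of_int n\<bar>" for n and k :: nat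
  proof -
    have "(of_nat k)\<^sup>2 \<le> 1 + (real_of_int n)\<^sup>2"
      using power_mono[OF that(2), of 2] by simp
    then have "h n \<le> ((of_nat k)\<^sup>2) powr (- q)"
      unfolding h_def using that assms by (intro powr_mono2') auto
    also have "\<dots> = of_nat k powr (- 2 * q)"
      using that by (simp add: power2_eq_square powr_mult flip: powr_add)
    finally show ?thesis .
  qed
  have summ: "summable (\<lambda>k. of_nat k powr (- 2 * q))"
    using assms by (simp add: summable_real_powr_iff)
  have half: "h summable_on range f" if "inj f" "\<And>k. of_nat k \<le> \<bar>real_of_int (f k)\<bar>" for f :: "nat \<Rightarrow> int"
  proof -
    have "summable (\<lambda>k. norm (h (f k)))"
      by (rule summable_comparison_test'[OF summ, of 1])
        (use bound that in \<open>auto simp: h_def\<close>)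
    then have "(h \<circ> f) summable_on UNIV"
      using norm_summable_imp_summable_on[of "\<lambda>k. h (f k)"] by (simp add: o_def)
    then show ?thesis using summable_on_reindex[OF that(1)] by blast
  qed
  have "n \<in> range int \<union> range (\<lambda>k. - 1 - int k)" for n
  proof (cases "n \<ge> 0")
    case True then show ?thesis by (intro UnI1 image_eqI[of _ _ "nat n"]) auto
  next
    case False then show ?thesis by (intro UnI2 image_eqI[of _ _ "nat (- 1 - n)"]) auto
  qed
  then have "UNIV = range int \<union> range (\<lambda>k. - 1 - int k)" by blast
  moreover have "h summable_on (range int \<union> range (\<lambda>k. - 1 - int k))"
    by (intro summable_on_Un_disjoint half) (auto simp: inj_on_def)
  ultimately show ?thesis by (simp add: h_def[abs_def])
qed

text \<open>
  The quantitative form of the Sobolev embedding into \<open>C\<^sup>j\<close>: by Cauchy--Schwarz with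
  \<open>\<bar>n\<bar>\<^sup>j \<le> (1 + n\<^sup>2)\<^bsup>(j - r)/2\<^esup> (1 + n\<^sup>2)\<^bsup>r/2\<^esup>\<close>, where the squares of the first factors are
  summable precisely because \<open>r - j > 1/2\<close>.
\<close>

lemma sobolev_weighted_l1_bound:
  assumes "r > real j + 1/2"
  obtains C where "\<And>f. f \<in> sobolev r \<Longrightarrow>
      (\<lambda>n. \<bar>real_of_int n\<bar> ^ j * cmod (fourier_coeff f n)) summable_on UNIV \<and>
      (\<Sum>\<^sub>\<infinity>n. \<bar>real_of_int n\<bar> ^ j * cmod (fourier_coeff f n)) \<le> C * sobolev_norm r f"
proof
  define wt where "wt n = 1 + (real_of_int n)\<^sup>2" for n
  have wt: "wt n > 0" for n by (simp add: wt_def add_pos_nonneg)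
  define V where "V n = wt n powr (real j - r)" for n
  have V: "V summable_on UNIV"
    using summable_on_int_bracket_powr[of "r - real j"] assms by (simp add: V_def[abs_def] wt_def)
  fix f assume "f \<in> sobolev r"
  define c where "c n = cmod (fourier_coeff f n)" for n
  have N: "(\<lambda>n. wt n powr r * (c n)\<^sup>2) summable_on UNIV"
    using \<open>f \<in> sobolev r\<close> by (simp add: sobolev_def wt_def c_def)
  have norm: "sobolev_norm r f = sqrt (\<Sum>\<^sub>\<infinity>n. wt n powr r * (c n)\<^sup>2)"
    by (simp add: sobolev_norm_def wt_def c_def)
  have fin: "(\<Sum>n\<in>F. \<bar>real_of_int n\<bar> ^ j * c n) \<le> sqrt (infsum V UNIV) * sobolev_norm r f"
    if "finite F" for F
  proof -
    have "\<bar>real_of_int n\<bar> ^ j * c n \<le> wt n powr ((real j - r) / 2) * (wt n powr (r / 2) * c n)" for n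
    proof -
      have "\<bar>real_of_int n\<bar> \<le> sqrt (wt n)"
        by (rule real_le_rsqrt) (simp add: wt_def)
      then have "\<bar>real_of_int n\<bar> ^ j \<le> sqrt (wt n) ^ j" by (intro power_mono) auto
      also have "\<dots> = wt n powr (real j / 2)"
        using wt[of n] by (simp add: powr_half_sqrt[symmetric] powr_powr powr_realpow[symmetric])
      also have "\<dots> = wt n powr ((real j - r) / 2) * wt n powr (r / 2)"
        by (simp add: diff_divide_distrib flip: powr_add)
      finally have "\<bar>real_of_int n\<bar> ^ j * c n \<le> (wt n powr ((real j - r) / 2) * wt n powr (r / 2)) * c n"
        by (rule mult_right_mono) (simp add: c_def)
      then show ?thesis by (simp only: mult.assoc)
    qed
    then have "(\<Sum>n\<in>F. \<bar>real_of_int n\<bar> ^ j * c n)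
        \<le> (\<Sum>n\<in>F. wt n powr ((real j - r) / 2) * (wt n powr (r / 2) * c n))"
      by (rule sum_mono)
    also have "\<dots> \<le> sqrt ((\<Sum>n\<in>F. (wt n powr ((real j - r) / 2))\<^sup>2) * (\<Sum>n\<in>F. (wt n powr (r / 2) * c n)\<^sup>2))"
      by (rule real_le_rsqrt) (rule Cauchy_Schwarz_ineq_sum)
    also have "\<dots> = sqrt (sum V F * (\<Sum>n\<in>F. wt n powr r * (c n)\<^sup>2))"
    proof -
      have "(x powr (z / 2))\<^sup>2 = x powr z" for x z :: real
        by (simp add: power2_eq_square flip: powr_add)
      then show ?thesis by (simp add: V_def power_mult_distrib)
    qed
    also have "\<dots> \<le> sqrt (infsum V UNIV * (\<Sum>\<^sub>\<infinity>n. wt n powr r * (c n)\<^sup>2))"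
      by (intro real_sqrt_le_mono mult_mono finite_sum_le_infsum V N that infsum_nonneg sum_nonneg)
        (auto simp: V_def)
    finally show ?thesis by (simp add: norm real_sqrt_mult)
  qed
  have "(\<lambda>n. \<bar>real_of_int n\<bar> ^ j * c n) summable_on UNIV"
    by (rule nonneg_bounded_partial_sums_imp_summable_on)
      (auto simp: c_def intro!: eventually_finite_subsets_at_top_weakI fin[unfolded c_def])
  moreover from this have "(\<Sum>\<^sub>\<infinity>n. \<bar>real_of_int n\<bar> ^ j * c n) \<le> sqrt (infsum V UNIV) * sobolev_norm r f"
    by (rule infsum_le_finite_sums) (use fin in auto)
  ultimately show "(\<lambda>n. \<bar>real_of_int n\<bar> ^ j * cmod (fourier_coeff f n)) summable_on UNIV \<and>
      (\<Sum>\<^sub>\<infinity>n. \<bar>real_of_int n\<bar> ^ j * cmod (fourier_coeff f n)) \<le> sqrt (infsum V UNIV) * sobolev_norm r f"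
    by (simp add: c_def)
qed

lemma sobolev_weighted_l1_summable:
  assumes "r > real j + 1/2" "f \<in> sobolev r"
  shows "(\<lambda>n. \<bar>real_of_int n\<bar> ^ j * cmod (fourier_coeff f n)) summable_on UNIV"
  by (rule sobolev_weighted_l1_bound[OF assms(1)]) (use assms(2) in blast)

definition deriv_fourier_coeff :: "(real \<Rightarrow> real) \<Rightarrow> int \<Rightarrow> complex" where
  "deriv_fourier_coeff f n = 2 * pi * \<i> * of_int n * fourier_coeff f n"

lemma norm_deriv_fourier_coeff: "norm (deriv_fourier_coeff f n) = 2 * pi * (\<bar>real_of_int n\<bar> * cmod (fourier_coeff f n))"
  by (simp add: deriv_fourier_coeff_def norm_mult)

lemma sobolev_deriv_fourier_coeff_summable:
  assumes "r > 3/2" "f \<in> sobolev r"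
  shows "(\<lambda>n. norm (deriv_fourier_coeff f n)) summable_on UNIV"
proof -
  have "(\<lambda>n. \<bar>real_of_int n\<bar> ^ 1 * cmod (fourier_coeff f n)) summable_on UNIV"
    using assms by (intro sobolev_weighted_l1_summable) auto
  then show ?thesis unfolding norm_deriv_fourier_coeff by (intro summable_on_cmult_right) simp
qed

lemma sobolev_has_derivative:
  assumes r: "r > 3/2" and f: "f \<in> sobolev r" "continuous_on UNIV f"
  shows "(f has_real_derivative Re (trig_series (deriv_fourier_coeff f) x)) (at x)"
proof -
  have "(\<lambda>n. \<bar>real_of_int n\<bar> ^ 0 * cmod (fourier_coeff f n)) summable_on UNIV"
    using r f by (intro sobolev_weighted_l1_summable) auto
  then have c: "(\<lambda>n. norm (fourier_coeff f n)) summable_on UNIV" by simp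
  have "(trig_series (fourier_coeff f) has_vector_derivative trig_series (deriv_fourier_coeff f) x) (at x)"
    using trig_series_has_vector_derivative[OF c] sobolev_deriv_fourier_coeff_summable[OF r f(1)]
    unfolding deriv_fourier_coeff_def by blast
  then have "((\<lambda>x. Re (trig_series (fourier_coeff f) x)) has_vector_derivative Re (trig_series (deriv_fourier_coeff f) x)) (at x)"
    by (rule bounded_linear.has_vector_derivative[OF bounded_linear_Re])
  moreover have "Re (trig_series (fourier_coeff f) x) = f x" for x
  proof -
    have "f (y + 1) = f y" for y using f(1) by (simp add: sobolev_def)
    then show ?thesis using fourier_inversion[OF f(2) _ c, of x, symmetric] by simp
  qed
  ultimately show ?thesis by (simp add: has_real_derivative_iff_has_vector_derivative)
qed

lemma sobolev_deriv:
  assumes "r > 3/2" "f \<in> sobolev r" "continuous_on UNIV f"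
  shows "deriv f x = Re (trig_series (deriv_fourier_coeff f) x)"
  using sobolev_has_derivative[OF assms] by (rule DERIV_imp_deriv)

lemma sobolev_DERIV_deriv:
  assumes "r > 3/2" "f \<in> sobolev r" "continuous_on UNIV f"
  shows "(f has_real_derivative deriv f x) (at x)"
  using sobolev_has_derivative[OF assms] sobolev_deriv[OF assms] by simp

lemma sobolev_deriv_bound:
  assumes "r > 3/2"
  obtains C where "\<And>f x. f \<in> sobolev r \<Longrightarrow> continuous_on UNIV f \<Longrightarrow> \<bar>deriv f x\<bar> \<le> C * sobolev_norm r f"
proof -
  have "real 1 + 1/2 < r" using assms by simp
  then obtain C where C: "\<And>f. f \<in> sobolev r \<Longrightarrow>
      (\<Sum>\<^sub>\<infinity>n. \<bar>real_of_int n\<bar> ^ 1 * cmod (fourier_coeff f n)) \<le> C * sobolev_norm r f"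
    by (rule sobolev_weighted_l1_bound) blast
  have "\<bar>deriv f x\<bar> \<le> (2 * pi * C) * sobolev_norm r f"
    if f: "f \<in> sobolev r" "continuous_on UNIV f" for f x
  proof -
    have "\<bar>deriv f x\<bar> \<le> norm (trig_series (deriv_fourier_coeff f) x)"
      unfolding sobolev_deriv[OF assms f] by (rule abs_Re_le_cmod)
    also have "\<dots> \<le> (\<Sum>\<^sub>\<infinity>n. norm (deriv_fourier_coeff f n))"
      by (rule norm_trig_series_le[OF sobolev_deriv_fourier_coeff_summable[OF assms f(1)]])
    also have "\<dots> = 2 * pi * (\<Sum>\<^sub>\<infinity>n. \<bar>real_of_int n\<bar> ^ 1 * cmod (fourier_coeff f n))"
      unfolding norm_deriv_fourier_coeff by (simp add: infsum_cmult_right')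
    also have "\<dots> \<le> 2 * pi * (C * sobolev_norm r f)"
      using C[OF f(1)] by (intro mult_left_mono) auto
    finally show ?thesis by (simp add: mult.assoc)
  qed
  then show ?thesis using that by blast
qed

lemma sobolev_deriv_differentiable:
  assumes r: "r > 5/2" and f: "f \<in> sobolev r" "continuous_on UNIV f"
  shows "\<exists>D. (deriv f has_real_derivative D) (at x)"
proof -
  let ?d = "\<lambda>n::int. 2 * pi * \<i> * of_int n * deriv_fourier_coeff f n"
  have r': "r > 3/2" using r by simp
  have "(\<lambda>n. \<bar>real_of_int n\<bar> ^ 2 * cmod (fourier_coeff f n)) summable_on UNIV"
    using r f by (intro sobolev_weighted_l1_summable) auto
  then have "(\<lambda>n. (2 * pi)\<^sup>2 * (\<bar>real_of_int n\<bar> ^ 2 * cmod (fourier_coeff f n))) summable_on UNIV"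
    by (rule summable_on_cmult_right)
  moreover have "norm (?d n) = (2 * pi)\<^sup>2 * (\<bar>real_of_int n\<bar> ^ 2 * cmod (fourier_coeff f n))" for n
    unfolding norm_mult norm_deriv_fourier_coeff by (simp add: power2_eq_square del: abs_mult_self_eq)
  ultimately have "(\<lambda>n. norm (?d n)) summable_on UNIV" by simp
  then have "(trig_series (deriv_fourier_coeff f) has_vector_derivative trig_series ?d x) (at x)"
    by (rule trig_series_has_vector_derivative[OF sobolev_deriv_fourier_coeff_summable[OF r' f(1)]])
  then have "((\<lambda>x. Re (trig_series (deriv_fourier_coeff f) x)) has_vector_derivative Re (trig_series ?d x)) (at x)"
    by (rule bounded_linear.has_vector_derivative[OF bounded_linear_Re])
  moreover have "deriv f = (\<lambda>x. Re (trig_series (deriv_fourier_coeff f) x))"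
    using sobolev_deriv[OF r' f] by blast
  ultimately show ?thesis by (auto simp: has_real_derivative_iff_has_vector_derivative)
qed

text \<open>
  The Sobolev norm is an infinite sum, which is \<open>0\<close> when it diverges. A small norm of a difference
  or of a difference quotient therefore carries information only once that function is known to lie
  in the Sobolev space.
\<close>

lemma sobolev_linear_combination:
  assumes f: "f \<in> sobolev r" "continuous_on UNIV f" and g: "g \<in> sobolev r" "continuous_on UNIV g"
  shows "(\<lambda>x. a * f x + b * g x) \<in> sobolev r"
proof -
  let ?l = "\<lambda>x. a * f x + b * g x"
  have cont: "continuous_on UNIV ?l" by (intro continuous_intros f g)
  have F: "fourier_coeff ?l n = of_real a * fourier_coeff f n + of_real b * fourier_coeff g n" for n
    using f(2) g(2) by (intro fourier_coeff_linear) (auto elim: continuous_on_subset)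
  let ?W = "\<lambda>f n. (1 + (real_of_int n)\<^sup>2) powr r * (cmod (fourier_coeff f n))\<^sup>2"
  have "(\<lambda>n. (2 * a\<^sup>2) * ?W f n + (2 * b\<^sup>2) * ?W g n) summable_on UNIV"
    using f g unfolding sobolev_def by (intro summable_on_add summable_on_cmult_right) auto
  moreover have "?W ?l n \<le> (2 * a\<^sup>2) * ?W f n + (2 * b\<^sup>2) * ?W g n" for n
  proof -
    have "(cmod (fourier_coeff ?l n))\<^sup>2 \<le> (\<bar>a\<bar> * cmod (fourier_coeff f n) + \<bar>b\<bar> * cmod (fourier_coeff g n))\<^sup>2"
      unfolding F by (intro power_mono order_trans[OF norm_triangle_ineq]) (auto simp: norm_mult)
    also have "\<dots> \<le> 2 * (\<bar>a\<bar> * cmod (fourier_coeff f n))\<^sup>2 + 2 * (\<bar>b\<bar> * cmod (fourier_coeff g n))\<^sup>2"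
      using zero_le_power2[of "\<bar>a\<bar> * cmod (fourier_coeff f n) - \<bar>b\<bar> * cmod (fourier_coeff g n)"]
      by (simp only: power2_sum power2_diff) 
    finally have "(cmod (fourier_coeff ?l n))\<^sup>2 \<le>
        (2 * a\<^sup>2) * (cmod (fourier_coeff f n))\<^sup>2 + (2 * b\<^sup>2) * (cmod (fourier_coeff g n))\<^sup>2"
      by (simp add: power_mult_distrib)
    then have "(1 + (real_of_int n)\<^sup>2) powr r * (cmod (fourier_coeff ?l n))\<^sup>2 \<le> (1 + (real_of_int n)\<^sup>2) powr r *
        ((2 * a\<^sup>2) * (cmod (fourier_coeff f n))\<^sup>2 + (2 * b\<^sup>2) * (cmod (fourier_coeff g n))\<^sup>2)"
      by (intro mult_left_mono) auto
    then show ?thesis by (simp add: algebra_simps)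
  qed
  ultimately have "?W ?l summable_on UNIV"
    by (rule summable_on_comparison_test) auto
  moreover have "set_integrable lborel {0..1} (\<lambda>x. (?l x)\<^sup>2)"
    by (intro borel_integrable_atLeastAtMost' continuous_on_power continuous_on_subset[OF cont]) simp
  moreover have "?l (x + 1) = ?l x" for x
    using f(1) g(1) by (simp add: sobolev_def)
  ultimately show ?thesis
    using cont by (auto simp: sobolev_def intro!: borel_measurable_continuous_onI)
qed

lemma sobolev_cont_deriv_uniform:
  assumes r: "r > 3/2" and f: "sobolev_cont r I f" "\<And>t. t \<in> I \<Longrightarrow> continuous_on UNIV (f t)"
    and t: "t \<in> I" and "\<epsilon> > 0"
  shows "\<forall>\<^sub>F \<tau> in at t within I. \<forall>x. \<bar>deriv (f \<tau>) x - deriv (f t) x\<bar> < \<epsilon>"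
proof -
  obtain C where C: "\<And>f x. f \<in> sobolev r \<Longrightarrow> continuous_on UNIV f \<Longrightarrow> \<bar>deriv f x\<bar> \<le> C * sobolev_norm r f"
    by (rule sobolev_deriv_bound[OF r]) blast
  have mem: "f \<tau> \<in> sobolev r" if "\<tau> \<in> I" for \<tau> using f(1) that by (simp add: sobolev_cont_def)
  have "((\<lambda>\<tau>. C * sobolev_norm r (\<lambda>x. f \<tau> x - f t x)) \<longlongrightarrow> C * 0) (at t within I)"
    using f(1) t by (intro tendsto_intros) (simp add: sobolev_cont_def)
  then have "\<forall>\<^sub>F \<tau> in at t within I. C * sobolev_norm r (\<lambda>x. f \<tau> x - f t x) < \<epsilon>"
    using \<open>\<epsilon> > 0\<close> by (intro order_tendstoD(2)) auto
  moreover have "\<forall>\<^sub>F \<tau> in at t within I. \<tau> \<in> I"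
    by (simp add: eventually_at_filter)
  ultimately show ?thesis
  proof eventually_elim
    case (elim \<tau>)
    have D: "(f \<sigma> has_real_derivative deriv (f \<sigma>) x) (at x)" if "\<sigma> \<in> I" for \<sigma> x
      using sobolev_DERIV_deriv[OF r mem f(2)] that by blast
    have "(\<lambda>x. f \<tau> x - f t x) \<in> sobolev r"
      using sobolev_linear_combination[OF mem f(2) mem f(2), of \<tau> t 1 "- 1"] elim t by simp
    moreover have "continuous_on UNIV (\<lambda>x. f \<tau> x - f t x)"
      using f(2) elim t by (intro continuous_intros) auto
    moreover have "deriv (\<lambda>x. f \<tau> x - f t x) x = deriv (f \<tau>) x - deriv (f t) x" for x
      using D elim t by (intro DERIV_imp_deriv derivative_intros) auto
    ultimately have "\<bar>deriv (f \<tau>) x - deriv (f t) x\<bar> \<le> C * sobolev_norm r (\<lambda>x. f \<tau> x - f t x)" for x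
      using C[of "\<lambda>x. f \<tau> x - f t x" x] by simp
    then show ?case using elim(1) by (auto intro: order_le_less_trans)
  qed
qed

text \<open>
  The interchange \<open>\<partial>\<^sub>t \<partial>\<^sub>x f = \<partial>\<^sub>x \<partial>\<^sub>t f\<close>: convergence of the difference quotients in time in a space
  that embeds into \<open>C\<^sup>1\<close> gives convergence of their slopes.
\<close>

lemma sobolev_C1_mixed_derivative:
  assumes r: "r > 3/2" and f: "sobolev_C1_deriv r I f f'"
    and cont: "\<And>t. t \<in> I \<Longrightarrow> continuous_on UNIV (f t)"
    and t: "t \<in> I" "continuous_on UNIV (f' t)"
  shows "((\<lambda>\<tau>. deriv (f \<tau>) x) has_real_derivative deriv (f' t) x) (at t within I)"
proof -
  obtain C where C: "\<And>f x. f \<in> sobolev r \<Longrightarrow> continuous_on UNIV f \<Longrightarrow> \<bar>deriv f x\<bar> \<le> C * sobolev_norm r f"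
    by (rule sobolev_deriv_bound[OF r]) blast
  have mem: "f \<tau> \<in> sobolev r" "f' \<tau> \<in> sobolev r" if "\<tau> \<in> I" for \<tau>
    using f that by (auto simp: sobolev_C1_deriv_def sobolev_cont_def)
  define Q where "Q \<tau> x = (f \<tau> x - f t x) / (\<tau> - t) - f' t x" for \<tau> x
  have bound: "norm ((deriv (f \<tau>) x - deriv (f t) x) / (\<tau> - t) - deriv (f' t) x) \<le> C * sobolev_norm r (Q \<tau>)"
    if "\<tau> \<in> I" for \<tau>
  proof -
    have c1: "continuous_on UNIV (\<lambda>x. 1 / (\<tau> - t) * f \<tau> x + (- 1 / (\<tau> - t)) * f t x)"
      using cont that t by (intro continuous_intros) auto
    have Q: "Q \<tau> = (\<lambda>x. 1 * (1 / (\<tau> - t) * f \<tau> x + (- 1 / (\<tau> - t)) * f t x) + (- 1) * f' t x)"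
      by (simp add: Q_def fun_eq_iff diff_divide_distrib)
    have "Q \<tau> \<in> sobolev r"
      unfolding Q by (intro sobolev_linear_combination mem cont that t c1)
    moreover have "continuous_on UNIV (Q \<tau>)"
      unfolding Q by (intro continuous_on_add continuous_on_mult continuous_on_const c1 t)
    ultimately have "\<bar>deriv (Q \<tau>) x\<bar> \<le> C * sobolev_norm r (Q \<tau>)" by (rule C)
    moreover have "deriv (Q \<tau>) x = (deriv (f \<tau>) x - deriv (f t) x) / (\<tau> - t) - deriv (f' t) x"
      unfolding Q_def
      by (intro DERIV_imp_deriv DERIV_diff DERIV_cdivide sobolev_DERIV_deriv[OF r] mem cont that t)
    ultimately show ?thesis by simp
  qed
  have lim: "((\<lambda>\<tau>. C * sobolev_norm r (Q \<tau>)) \<longlongrightarrow> C * 0) (at t within I)"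
    using f t(1) unfolding Q_def by (intro tendsto_intros) (simp add: sobolev_C1_deriv_def)
  have "\<forall>\<^sub>F \<tau> in at t within I. norm ((deriv (f \<tau>) x - deriv (f t) x) / (\<tau> - t) - deriv (f' t) x)
        \<le> C * sobolev_norm r (Q \<tau>)"
    unfolding eventually_at_filter using bound by (intro always_eventually) blast
  then have "((\<lambda>\<tau>. (deriv (f \<tau>) x - deriv (f t) x) / (\<tau> - t) - deriv (f' t) x) \<longlongrightarrow> 0) (at t within I)"
    by (rule Lim_null_comparison) (use lim in simp)
  then show ?thesis
    unfolding has_field_derivative_iff by (rule LIM_zero_cancel)
qed

section \<open>Comparison with a Riccati equation\<close>

text \<open>
  Consider the last time before \<open>b\<close> at which \<open>y \<ge> z\<close>. If \<open>y > z\<close> there, continuity carries the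
  inequality a little further, and if \<open>y = z\<close> the hypothesis \<open>step\<close> does.
\<close>

lemma barrier_comparison:
  fixes y z :: "real \<Rightarrow> real"
  assumes cont: "continuous_on {a..b} y" "continuous_on {a..b} z"
    and start: "z a \<le> y a"
    and step: "\<And>t. a \<le> t \<Longrightarrow> t < b \<Longrightarrow> y t = z t \<Longrightarrow> \<forall>\<^sub>F \<tau> in at_right t. z \<tau> \<le> y \<tau>"
    and "a \<le> b"
  shows "z b \<le> y b"
proof (rule ccontr)
  assume neg: "\<not> z b \<le> y b"
  define S where "S = {t \<in> {a..b}. 0 \<le> y t - z t}"
  have "closed S"
  proof -
    have "continuous_on {a..b} (\<lambda>t. y t - z t)" by (intro continuous_intros cont)
    from continuous_closed_preimage[OF this closed_atLeastAtMost closed_atLeast[of 0]]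
    show ?thesis by (simp add: S_def vimage_def Int_def)
  qed
  have "a \<in> S" using start \<open>a \<le> b\<close> by (simp add: S_def)
  have bdd: "bdd_above S" by (auto simp: S_def)
  define m where "m = Sup S"
  have "m \<in> S"
    unfolding m_def using \<open>closed S\<close> \<open>a \<in> S\<close> bdd by (intro closed_contains_Sup) auto
  then have m: "a \<le> m" "m < b" "z m \<le> y m"
    using neg by (auto simp: S_def less_le)
  have "\<forall>\<^sub>F \<tau> in at_right m. z \<tau> \<le> y \<tau>"
  proof (cases "y m = z m")
    case True then show ?thesis using step m by simp
  next
    case False
    have "((\<lambda>\<tau>. y \<tau> - z \<tau>) \<longlongrightarrow> y m - z m) (at m within {a..b})"
      using cont m by (intro tendsto_intros) (auto simp: continuous_on_def)
    then have "\<forall>\<^sub>F \<tau> in at m within {a..b}. 0 < y \<tau> - z \<tau>"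
      using False m by (intro order_tendstoD(1)) auto
    then have "\<forall>\<^sub>F \<tau> in at m within {m..b}. 0 < y \<tau> - z \<tau>"
      using m by (elim filter_leD[rotated]) (auto intro: at_le)
    then have "\<forall>\<^sub>F \<tau> in at_right m. 0 < y \<tau> - z \<tau>"
      using m by (simp add: at_within_Icc_at_right)
    then show ?thesis by eventually_elim simp
  qed
  moreover have "\<forall>\<^sub>F \<tau> in at_right m. \<tau> \<in> {m<..<b}"
    using m by (intro eventually_at_right_real)
  ultimately have "\<forall>\<^sub>F \<tau> in at_right m. \<tau> \<in> S \<and> \<tau> > m"
    by eventually_elim (use m in \<open>auto simp: S_def\<close>)
  then obtain \<tau> where "\<tau> \<in> S" "\<tau> > m"
    using eventually_happens[of _ "at_right m"] by (auto simp: trivial_limit_at_right_real)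
  then show False using cSup_upper[OF _ bdd, of \<tau>] by (simp add: m_def)
qed

text \<open>
  The growth hypothesis says that the lower right Dini derivative of \<open>y\<close> is at least
  \<open>y\<^sup>2/2 - a\<close>; a running extremum of smooth functions has no more regularity than that. Choose
  \<open>p < y 0\<close> that still satisfies \<open>p > 0\<close> and \<open>p\<^sup>2 > 2 a\<close>. For a small constant \<open>c > 0\<close>
  one has \<open>c v\<^sup>2 < v\<^sup>2/2 - a\<close> for all \<open>v \<ge> p\<close>, so the solution of
  \<open>z' = c z\<^sup>2\<close>, \<open>z 0 = p\<close>, is a strict subsolution and stays below \<open>y\<close>. It tends to infinity
  at \<open>1 / (c p)\<close>, whereas \<open>y\<close> is bounded on compact intervals. The growth hypothesis is
  not available at time \<open>0\<close>; the strict inequality \<open>p < y 0\<close> compensates for this.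
\<close>

lemma riccati_no_global_solution:
  fixes y :: "real \<Rightarrow> real"
  assumes cont: "continuous_on {0..} y"
    and growth: "\<And>t \<epsilon>. t > 0 \<Longrightarrow> \<epsilon> > 0 \<Longrightarrow>
      \<forall>\<^sub>F \<tau> in at_right t. y t + (\<tau> - t) * ((y t)\<^sup>2 / 2 - a - \<epsilon>) \<le> y \<tau>"
    and start: "0 < y 0" "sqrt (2 * a) < y 0"
  shows False
proof -
  obtain p where "max 0 (sqrt (2 * a)) < p" "p < y 0"
    using dense[of "max 0 (sqrt (2 * a))" "y 0"] start by auto
  then have p: "0 < p" "sqrt (2 * a) < p" "p < y 0" by auto
  have pa: "p\<^sup>2 / 2 - a > 0"
  proof (cases "a \<le> 0")
    case True then show ?thesis using p(1) by (smt (verit) zero_less_power2 divide_pos_pos)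
  next
    case False
    then have "(sqrt (2 * a))\<^sup>2 < p\<^sup>2" using p by (intro power_strict_mono) auto
    then show ?thesis using False by simp
  qed
  \<comment> \<open>Any \<open>c < 1/2\<close> makes \<open>v\<^sup>2/2 - c v\<^sup>2\<close> increasing in \<open>v > 0\<close>, so that the gap need only be checked at \<open>v = p\<close>.\<close>
  define c where "c = min (1/4) ((p\<^sup>2 / 2 - a) / (2 * p\<^sup>2))"
  have c: "0 < c" "c \<le> 1/4" using pa p by (auto simp: c_def)
  have "c * p\<^sup>2 \<le> (p\<^sup>2 / 2 - a) / (2 * p\<^sup>2) * p\<^sup>2"
    by (intro mult_right_mono) (auto simp: c_def)
  then have cp: "c * p\<^sup>2 < p\<^sup>2 / 2 - a" using p pa by simp
  have gap: "c * v\<^sup>2 < v\<^sup>2 / 2 - a" if "p \<le> v" for v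
  proof -
    have "(1/2 - c) * p\<^sup>2 \<le> (1/2 - c) * v\<^sup>2"
      using that p c by (intro mult_left_mono power_mono) auto
    then show ?thesis using cp by (simp add: algebra_simps)
  qed
  define q where "q t = 1 - c * p * t" for t
  define z where "z t = p / q t" for t
  define t1 where "t1 = 1 / (c * p)"
  have t1: "0 < t1" using c p by (simp add: t1_def)
  have q: "0 < q t" if "t < t1" for t
    using that c p by (simp add: q_def t1_def field_simps)
  have z_deriv: "(z has_real_derivative c * (z t)\<^sup>2) (at t)" if "t < t1" for t
    unfolding z_def q_def using q[OF that]
    by (auto intro!: derivative_eq_intros simp: q_def power2_eq_square)
  have z_ge: "p \<le> z t" if "0 \<le> t" "t < t1" for t
  proof -
    have "q t \<le> 1" using that c p by (simp add: q_def)
    then show ?thesis using q[OF that(2)] p by (simp add: z_def field_simps)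
  qed
  have above: "z b \<le> y b" if b: "0 \<le> b" "b < t1" for b
  proof (rule barrier_comparison[of 0 b])
    show "continuous_on {0..b} y" using cont by (rule continuous_on_subset) auto
    show "continuous_on {0..b} z"
      using z_deriv b by (intro DERIV_continuous_on[of _ z "\<lambda>t. c * (z t)\<^sup>2"])
        (auto intro: has_field_derivative_at_within)
    show "z 0 \<le> y 0" using p by (simp add: z_def q_def)
    fix t assume t: "0 \<le> t" "t < b" "y t = z t"
    have "t \<noteq> 0" using t p by (auto simp: z_def q_def)
    then have "t > 0" using t by simp
    have tt: "t < t1" using t b by simp
    define \<epsilon> where "\<epsilon> = ((z t)\<^sup>2 / 2 - a - c * (z t)\<^sup>2) / 2"
    have eps: "\<epsilon> > 0" using gap[OF z_ge[OF t(1) tt]] by (simp add: \<epsilon>_def)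
    have "((\<lambda>\<tau>. (z \<tau> - z t) / (\<tau> - t)) \<longlongrightarrow> c * (z t)\<^sup>2) (at t)"
      using z_deriv[OF tt] by (simp add: has_field_derivative_iff)
    then have "\<forall>\<^sub>F \<tau> in at t. (z \<tau> - z t) / (\<tau> - t) < c * (z t)\<^sup>2 + \<epsilon>"
      using eps by (intro order_tendstoD(2)) auto
    then have "\<forall>\<^sub>F \<tau> in at_right t. (z \<tau> - z t) / (\<tau> - t) < c * (z t)\<^sup>2 + \<epsilon>"
      by (rule filter_leD[rotated]) (simp add: at_le)
    moreover have "\<forall>\<^sub>F \<tau> in at_right t. t < \<tau>" by (simp add: eventually_at_right_less)
    moreover note growth[OF \<open>t > 0\<close> eps]
    ultimately show "\<forall>\<^sub>F \<tau> in at_right t. z \<tau> \<le> y \<tau>"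
    proof eventually_elim
      case (elim \<tau>)
      have "z \<tau> - z t < (c * (z t)\<^sup>2 + \<epsilon>) * (\<tau> - t)"
        using elim(1,2) by (simp add: pos_divide_less_eq)
      also have "c * (z t)\<^sup>2 + \<epsilon> = (y t)\<^sup>2 / 2 - a - \<epsilon>"
        by (simp add: \<epsilon>_def t(3) field_simps)
      finally show ?case using elim(3) t(3) by (simp add: mult.commute)
    qed
  qed (use b in auto)
  have "compact (y ` {0..t1})"
    using cont by (intro compact_continuous_image) (auto elim: continuous_on_subset)
  then have "bounded (y ` {0..t1})" by (rule compact_imp_bounded)
  then obtain M where M: "\<forall>t\<in>{0..t1}. \<bar>y t\<bar> \<le> M"
    unfolding bounded_iff by auto
  define N where "N = max M p + 1"
  have N: "M < N" "p < N" "0 < N" using p by (auto simp: N_def)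
  \<comment> \<open>The time at which the barrier has the value \<open>N\<close>.\<close>
  define b where "b = (1 - p / N) * t1"
  have b: "0 \<le> b" "b < t1" using N p t1 by (auto simp: b_def)
  have "q b = p / N" using c p by (simp add: q_def b_def t1_def)
  then have "z b = N" using p N by (simp add: z_def)
  then show False using above[OF b] bspec[OF M, of b] b N by auto
qed

section \<open>The minimal slope of a solution\<close>

lemma dx_inv_has_derivative:
  assumes "continuous_on UNIV g"
  shows "(dx_inv g has_real_derivative g x) (at x)"
proof -
  have "((\<lambda>u. LBINT y=ereal 0..u. g y) has_vector_derivative g x) (at x within {min 0 x - 1..max 0 x + 1})"
    using assms by (intro interval_integral_FTC2) (auto elim: continuous_on_subset)
  moreover have "at x within {min 0 x - 1..max 0 x + 1} = at x"
    by (rule at_within_interior) auto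
  ultimately show ?thesis
    by (simp add: dx_inv_def[abs_def] has_real_derivative_iff_has_vector_derivative zero_ereal_def)
qed

lemma deriv_periodic:
  fixes f :: "real \<Rightarrow> real"
  assumes "\<And>x. f (x + 1) = f x" "\<And>x. (f has_real_derivative deriv f x) (at x)"
  shows "deriv f (x + 1) = deriv f x"
proof -
  have "((\<lambda>x. f (x + 1)) has_real_derivative deriv f (x + 1)) (at x)"
    using assms(2)[of "x + 1"] by (simp add: DERIV_shift)
  then have "(f has_real_derivative deriv f (x + 1)) (at x)"
    using assms(1) by simp
  then show ?thesis by (simp add: DERIV_imp_deriv)
qed

text \<open>
  Solving the equation for the time derivative \<open>ft\<close> exhibits it as a \<open>C\<^sup>1\<close> function of \<open>x\<close>, whose slope can be
  read off. The transport term contributes \<open>- (f')\<^sup>2 - f f''\<close>, which turns the \<open>+ 1/2\<close> in front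
  of \<open>(f')\<^sup>2\<close> into \<open>- 1/2\<close>.
\<close>

lemma hs_slope_equation:
  assumes s: "s > 5/2" and f: "f \<in> sobolev s" "continuous_on UNIV f" and "continuous_on UNIV \<rho>"
    and eq: "\<And>x. ft x + f x * deriv f x =
        dx_inv (\<lambda>y. k/2 * (\<rho> y)\<^sup>2 + 1/2 * (deriv f y)\<^sup>2 + a) x + c"
  obtains "continuous_on UNIV ft"
    "\<And>x D. (deriv f has_real_derivative D) (at x) \<Longrightarrow>
       deriv ft x = k/2 * (\<rho> x)\<^sup>2 - 1/2 * (deriv f x)\<^sup>2 - f x * D + a"
proof -
  have s': "s > 3/2" using s by simp
  have D1: "(f has_real_derivative deriv f x) (at x)" for x
    by (rule sobolev_DERIV_deriv[OF s' f])
  have contw: "continuous_on UNIV (deriv f)"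
    using sobolev_deriv_differentiable[OF s f] by (meson DERIV_isCont continuous_at_imp_continuous_on)
  let ?g = "\<lambda>y. k/2 * (\<rho> y)\<^sup>2 + 1/2 * (deriv f y)\<^sup>2 + a"
  have contg: "continuous_on UNIV ?g"
    by (intro continuous_intros contw assms)
  have ft: "ft = (\<lambda>x. dx_inv ?g x + c - f x * deriv f x)"
    using eq by (simp add: fun_eq_iff algebra_simps)
  have D: "(ft has_real_derivative (k/2 * (\<rho> x)\<^sup>2 - 1/2 * (deriv f x)\<^sup>2 - f x * D + a)) (at x)"
    if "(deriv f has_real_derivative D) (at x)" for x D
    unfolding ft using that D1 dx_inv_has_derivative[OF contg, of x]
    by (auto intro!: derivative_eq_intros simp: power2_eq_square)
  have "continuous_on UNIV ft"
    using D sobolev_deriv_differentiable[OF s f] by (meson DERIV_isCont continuous_at_imp_continuous_on)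
  then show ?thesis using that D DERIV_imp_deriv by blast
qed

text \<open>
  The heart of the argument. At a minimum \<open>\<xi>\<close> of the slope \<open>w t\<close>, the second derivative of \<open>u t\<close> vanishes, and the
  slope equation gives \<open>\<partial>\<^sub>t w \<le> a - w\<^sup>2/2\<close> there, the density entering with a favourable sign.
  For later \<open>\<tau>\<close> the minimal slope is at most \<open>w \<tau> \<xi>\<close>, so minus the minimal slope satisfies the
  hypothesis of the Riccati comparison.

  Two inequalities are stated because the real square root is extended to an odd function: for
  \<open>a \<le> 0\<close> the second one follows from the first, and for \<open>a > 0\<close> it is the stronger one.
\<close>

lemma hs_global_solution_not_steep:
  assumes sol: "hs_solution (-1) h s u0 \<rho>0 \<infinity> u \<rho>" and s: "s > 5/2"
  shows "\<not> (deriv u0 x0 < 0 \<and> deriv u0 x0 < - sqrt (2 * hs_const (-1) u0 \<rho>0))"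
proof
  assume neg: "deriv u0 x0 < 0 \<and> deriv u0 x0 < - sqrt (2 * hs_const (-1) u0 \<rho>0)"
  define a where "a = hs_const (-1) u0 \<rho>0"
  have I: "time_interval \<infinity> = {0..}" by (auto simp: time_interval_def)
  have s': "s > 3/2" "s - 1 > 3/2" using s by auto
  obtain ut where cu: "sobolev_cont s {0..} u"
    and cont: "\<And>t. t \<ge> 0 \<Longrightarrow> continuous_on UNIV (u t)" "\<And>t. t \<ge> 0 \<Longrightarrow> continuous_on UNIV (\<rho> t)"
    and "u 0 = u0"
    and C1: "sobolev_C1_deriv (s - 1) {0..} u ut"
    and eq: "\<And>t x. t > 0 \<Longrightarrow> ut t x + u t x * deriv (u t) x =
         dx_inv (\<lambda>y. (-1)/2 * (\<rho> t y)\<^sup>2 + 1/2 * (deriv (u t) y)\<^sup>2 + a) x + h t"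
    using sol unfolding hs_solution_def I a_def by auto
  have mem: "u t \<in> sobolev s" if "t \<ge> 0" for t using cu that by (simp add: sobolev_cont_def)
  define w where "w t = deriv (u t)" for t
  have contw: "continuous_on UNIV (w t)" if "t \<ge> 0" for t
    unfolding w_def using sobolev_deriv_differentiable[OF s mem[OF that] cont(1)[OF that]]
    by (meson DERIV_isCont continuous_at_imp_continuous_on)
  have per: "w t (x + 1) = w t x" if "t \<ge> 0" for t x
    unfolding w_def using mem[OF that] sobolev_DERIV_deriv[OF s'(1) mem cont(1)] that
    by (intro deriv_periodic) (auto simp: sobolev_def)
  have "\<exists>x. \<forall>y. w t x \<le> w t y" if t: "t \<ge> 0" for t
  proof -
    obtain x where x: "\<And>y. y \<in> {0..1} \<Longrightarrow> w t x \<le> w t y"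
      using continuous_attains_inf[of "{0..1}" "w t"] continuous_on_subset[OF contw[OF t] subset_UNIV] by fastforce
    have "w t x \<le> w t y" for y
      using x[of "frac y"] periodic_reduce_unit_interval[of "w t" y, OF per[OF t]]
      by (simp add: frac_ge_0 less_imp_le frac_lt_1)
    then show ?thesis by blast
  qed
  then obtain \<xi> where \<xi>: "\<And>t y. t \<ge> 0 \<Longrightarrow> w t (\<xi> t) \<le> w t y" by metis
  define m where "m t = - w t (\<xi> t)" for t
  have m_ge: "- w t y \<le> m t" if "t \<ge> 0" for t y using \<xi>[OF that, of y] by (simp add: m_def)
  \<comment> \<open>Uniform closeness of two functions bounds the distance of their minima.\<close>
  have m_cont: "continuous_on {0..} m"
    unfolding continuous_on_def
  proof (intro ballI tendstoI)
    fix t \<epsilon> :: real assume t: "t \<in> {0..}" and "\<epsilon> > 0"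
    have "\<forall>\<^sub>F \<tau> in at t within {0..}. \<tau> \<in> {0..}" by (simp add: eventually_at_filter)
    moreover have "\<forall>\<^sub>F \<tau> in at t within {0..}. \<forall>x. \<bar>w \<tau> x - w t x\<bar> < \<epsilon>"
      unfolding w_def by (rule sobolev_cont_deriv_uniform[OF s'(1) cu cont(1) t \<open>\<epsilon> > 0\<close>]) simp
    ultimately show "\<forall>\<^sub>F \<tau> in at t within {0..}. dist (m \<tau>) (m t) < \<epsilon>"
    proof eventually_elim
      case (elim \<tau>)
      have "\<bar>w \<tau> (\<xi> \<tau>) - w t (\<xi> \<tau>)\<bar> < \<epsilon>" "\<bar>w \<tau> (\<xi> t) - w t (\<xi> t)\<bar> < \<epsilon>" using elim(2) by auto
      moreover have "w \<tau> (\<xi> \<tau>) \<le> w \<tau> (\<xi> t)" "w t (\<xi> t) \<le> w t (\<xi> \<tau>)" using \<xi> elim(1) t by auto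
      ultimately show ?case by (simp add: m_def dist_real_def abs_less_iff)
    qed
  qed
  have growth: "\<forall>\<^sub>F \<tau> in at_right t. m t + (\<tau> - t) * ((m t)\<^sup>2 / 2 - a - \<epsilon>) \<le> m \<tau>"
    if t: "t > 0" and \<epsilon>: "\<epsilon> > 0" for t \<epsilon>
  proof -
    obtain D where D: "(w t has_real_derivative D) (at (\<xi> t))"
      using sobolev_deriv_differentiable[OF s mem cont(1), of t "\<xi> t"] t by (auto simp: w_def)
    have "D = 0"
      using DERIV_local_min[OF D, of 1] \<xi>[of t] t by simp
    \<comment> \<open>Only positive times occur here, the only ones at which the equation is imposed.\<close>
    have "continuous_on UNIV (ut t)"
      and "deriv (ut t) (\<xi> t) = (-1)/2 * (\<rho> t (\<xi> t))\<^sup>2 - 1/2 * (w t (\<xi> t))\<^sup>2 - u t (\<xi> t) * D + a"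
      using hs_slope_equation[OF s mem cont eq, of t] D t by (auto simp: w_def)
    then have cut: "continuous_on UNIV (ut t)" and le: "deriv (ut t) (\<xi> t) \<le> a - (m t)\<^sup>2 / 2"
      by (auto simp: \<open>D = 0\<close> m_def)
    have "((\<lambda>\<tau>. w \<tau> (\<xi> t)) has_real_derivative deriv (ut t) (\<xi> t)) (at t within {0..})"
      unfolding w_def using cont t cut by (intro sobolev_C1_mixed_derivative[OF s'(2) C1]) auto
    then have "((\<lambda>\<tau>. (w \<tau> (\<xi> t) - w t (\<xi> t)) / (\<tau> - t)) \<longlongrightarrow> deriv (ut t) (\<xi> t)) (at t within {0..})"
      by (simp add: has_field_derivative_iff)
    then have "\<forall>\<^sub>F \<tau> in at t within {0..}. (w \<tau> (\<xi> t) - w t (\<xi> t)) / (\<tau> - t) < a - (m t)\<^sup>2 / 2 + \<epsilon>"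
      using le \<epsilon> by (intro order_tendstoD(2)) auto
    then have "\<forall>\<^sub>F \<tau> in at_right t. (w \<tau> (\<xi> t) - w t (\<xi> t)) / (\<tau> - t) < a - (m t)\<^sup>2 / 2 + \<epsilon>"
      using t by (elim filter_leD[rotated]) (auto intro: at_le)
    moreover have "\<forall>\<^sub>F \<tau> in at_right t. t < \<tau>" by (simp add: eventually_at_right_less)
    ultimately show ?thesis
    proof eventually_elim
      case (elim \<tau>)
      have "w \<tau> (\<xi> t) - w t (\<xi> t) < (a - (m t)\<^sup>2 / 2 + \<epsilon>) * (\<tau> - t)"
        using elim by (simp add: pos_divide_less_eq)
      moreover have "- w \<tau> (\<xi> t) \<le> m \<tau>" using m_ge elim t by simp
      ultimately show ?case by (simp add: m_def algebra_simps)
    qed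
  qed
  have "- deriv u0 x0 \<le> m 0" using m_ge[of 0 x0] \<open>u 0 = u0\<close> by (simp add: w_def)
  then show False
    using riccati_no_global_solution[OF m_cont growth] neg by (simp add: a_def)
qed

section \<open>Blow-up\<close>

text \<open>
  A periodic function that is nondecreasing is constant.
\<close>

lemma periodic_nondecreasing_imp_deriv_eq_0:
  fixes f :: "real \<Rightarrow> real"
  assumes per: "\<And>x. f (x + 1) = f x" and D: "\<And>x. (f has_real_derivative deriv f x) (at x)"
    and nonneg: "\<And>x. 0 \<le> deriv f x"
  shows "deriv f x = 0"
proof -
  have mono: "f x \<le> f y" if "x \<le> y" for x y
    using DERIV_nonneg_imp_nondecreasing[OF that] D nonneg by blast
  have "f y = f x" if "y \<in> {x<..<x+1}" for x y
    using mono[of x y] mono[of y "x + 1"] per[of x] that by simp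
  then have "f y = f (x - 1/2)" if "y \<in> {x-1/2<..<x+1/2}" for y
    using that by simp
  then have "((\<lambda>_. f (x - 1/2)) has_real_derivative deriv f x) (at x)"
    using D[of x] by (elim has_field_derivative_transform_within_open[of _ _ _ "{x-1/2<..<x+1/2}"]) auto
  then show ?thesis using DERIV_unique DERIV_const by blast
qed

theorem theorem4p2:
  fixes h :: "real \<Rightarrow> real" and s a :: real and T :: ereal
    and u0 \<rho>0 :: "real \<Rightarrow> real" and u \<rho> :: "real \<Rightarrow> real \<Rightarrow> real"
  assumes "continuous_on {0..} h"
    and "s > 5/2"
    and "u0 \<in> sobolev s" and "\<rho>0 \<in> sobolev (s - 1)"
    and "continuous_on UNIV u0" and "continuous_on UNIV \<rho>0"
    and "hs_maximal_solution (-1) h s u0 \<rho>0 T u \<rho>"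
    and "a = 1/2 * (LBINT x=0..1. (\<rho>0 x)\<^sup>2 - (deriv u0 x)\<^sup>2)"
    and "a < 0
       \<or> (a > 0 \<and> (\<exists>x0. deriv u0 x0 < - sqrt (2 * a)))
       \<or> (a = 0 \<and> (\<exists>x0. deriv u0 x0 \<le> 0 \<and> \<rho>0 x0 \<noteq> 0))"
  shows "blows_up_in_finite_time T"
proof (rule ccontr)
  assume "\<not> blows_up_in_finite_time T"
  then have T: "T = \<infinity>" by (simp add: blows_up_in_finite_time_def)
  have a: "hs_const (-1) u0 \<rho>0 = a"
  proof -
    have "(LBINT x=0..1. (-1) * (\<rho>0 x)\<^sup>2 + (deriv u0 x)\<^sup>2) = (LBINT x=0..1. - ((\<rho>0 x)\<^sup>2 - (deriv u0 x)\<^sup>2))"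
      by simp
    also have "\<dots> = - (LBINT x=0..1. (\<rho>0 x)\<^sup>2 - (deriv u0 x)\<^sup>2)"
      by (rule interval_lebesgue_integral_uminus)
    finally show ?thesis unfolding hs_const_def assms(8) by simp
  qed
  have bound: "\<not> (deriv u0 x0 < 0 \<and> deriv u0 x0 < - sqrt (2 * a))" for x0
    using hs_global_solution_not_steep[of h s u0 \<rho>0 u \<rho>] assms(2,7) by (simp add: hs_maximal_solution_def T a)
  \<comment> \<open>For \<open>a > 0\<close> the assumed steep point is excluded at once. Otherwise no slope at all may be negative.\<close>
  have "a \<le> 0"
  proof (rule ccontr)
    assume "\<not> a \<le> 0"
    then obtain x0 where x0: "deriv u0 x0 < - sqrt (2 * a)" using assms(9) by auto
    have "0 < sqrt (2 * a)" using \<open>\<not> a \<le> 0\<close> by simp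
    then show False using bound[of x0] x0 by linarith
  qed
  have "0 \<le> deriv u0 x" for x
  proof (rule ccontr)
    assume "\<not> 0 \<le> deriv u0 x"
    moreover have "sqrt (2 * a) \<le> 0" using \<open>a \<le> 0\<close> by simp
    ultimately show False using bound[of x] by linarith
  qed
  moreover have "u0 (x + 1) = u0 x" and per: "\<rho>0 (x + 1) = \<rho>0 x" for x
    using assms(3,4) by (auto simp: sobolev_def)
  \<comment> \<open>Hence \<open>a\<close> is half the integral of \<open>\<rho>0\<^sup>2\<close>, which refutes the remaining two cases.\<close>
  ultimately have "deriv u0 x = 0" for x
    using sobolev_DERIV_deriv[of s u0] assms(2,3,5) by (intro periodic_nondecreasing_imp_deriv_eq_0) auto
  then have "a = 1/2 * (LBINT x=0..1. (\<rho>0 x)\<^sup>2)" using assms(8) by simp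
  moreover have c\<rho>: "continuous_on {0..1} (\<lambda>x. (\<rho>0 x)\<^sup>2)"
    using assms(6) by (intro continuous_intros) (auto elim: continuous_on_subset)
  then have "(LBINT x=0..1. (\<rho>0 x)\<^sup>2) = integral {0..1} (\<lambda>x. (\<rho>0 x)\<^sup>2)"
    using interval_integral_eq_integral[of 0 1 "\<lambda>x. (\<rho>0 x)\<^sup>2"] borel_integrable_atLeastAtMost'[OF c\<rho>]
    by (simp add: zero_ereal_def one_ereal_def)
  moreover have "0 \<le> integral {0..1} (\<lambda>x. (\<rho>0 x)\<^sup>2)"
    by (intro integral_nonneg integrable_continuous_real c\<rho>) simp
  ultimately have "a = 0" and "integral {0..1} (\<lambda>x. (\<rho>0 x)\<^sup>2) = 0"
    using \<open>a \<le> 0\<close> by auto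
  then have "\<rho>0 x = 0" if "x \<in> {0..1}" for x
    using integral_eq_0_iff[OF c\<rho>] that by auto
  then have "\<rho>0 x = 0" for x
    using periodic_reduce_unit_interval[of \<rho>0 x, OF per] by (metis atLeastAtMost_iff frac_ge_0 frac_lt_1 less_imp_le)
  then show False using assms(9) \<open>a = 0\<close> by simp
qed

end
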